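(* Let $A=(A,\cdot,\circ)$ be a bi-skew brace, let $A_{\leftrightarrow}=(A,\circ,\cdot)$ be the skew brace obtained by swapping the two operations, and let $n$ be a nonnegative integer. Then $A$ is left nilpotent of class $n$ if and only if $A_{\leftrightarrow}$ is left nilpotent of class $n$; and $A$ is right nilpotent of class $n$ if and only if $A_{\leftrightarrow}$ is right nilpotent of class $n$.
   Context: A skew brace (meaning skew left brace) is a set $A$ with two group structures $(A,\cdot)$ (the additive group) and $(A,\circ)$ (the multiplicative group) such that $a\circ(b\cdot c)=(a\circ b)\cdot a^{-1}\cdot(a\circ c)$ for all $a,b,c\in A$, where $a^{-1}$ is the inverse of $a$ in $(A,\cdot)$. The two groups have the same neutral element, denoted $1$. A bi-skew brace is a skew brace $(A,\cdot,\circ)$ such that $(A,\circ,\cdot)$ is also a skew brace. For a skew brace $(A,\cdot,\circ)$ and $a,b\in A$ put $a*b=a^{-1}\cdot(a\circ b)\cdot b^{-1}$. For subsets $X,Y\subseteq A$, $X*Y$ is the subgroup of the additive group $(A,\cdot)$ generated by $\{x*y\mid x\in X,\ y\in Y\}$. Set $A^{(1)}=A^1=A$, and for $m\ge2$ set $A^{(m)}=A^{(m-1)}*A$ and $A^{m}=A*A^{m-1}$. The skew brace $A$ is right nilpotent (respectively left nilpotent) if $A^{(m)}=\{1\}$ (respectively $A^{m}=\{1\}$) for some $m\ge1$; if $m$ is minimal with this property, $m-1$ is called the right (respectively left) nilpotency class of $A$. For $A_{\leftrightarrow}$ all these notions are applied to the skew brace $(A,\circ,\cdot)$, whose additive group is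 $(A,\circ)$. *)

theory Defs
  imports "HOL-Algebra.Generated_Groups"
begin

(* A skew (left) brace is given by its additive group G and its multiplicative group M,
   which share one carrier. That the two neutral elements agree is a consequence. *)
locale skew_brace = add: group G + mult: group M
  for G :: "('a, 'b) monoid_scheme" and M :: "('a, 'c) monoid_scheme" +
  assumes carrier_eq: "carrier M = carrier G"
    and brace: "\<lbrakk>a \<in> carrier G; b \<in> carrier G; c \<in> carrier G\<rbrakk> \<Longrightarrow>
      a \<otimes>\<^bsub>M\<^esub> (b \<otimes>\<^bsub>G\<^esub> c) = (a \<otimes>\<^bsub>M\<^esub> b) \<otimes>\<^bsub>G\<^esub> inv\<^bsub>G\<^esub> a \<otimes>\<^bsub>G\<^esub> (a \<otimes>\<^bsub>M\<^esub> c)"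

definition bi_skew_brace ::
  "('a, 'b) monoid_scheme \<Rightarrow> ('a, 'c) monoid_scheme \<Rightarrow> bool" where
  "bi_skew_brace G M \<longleftrightarrow> skew_brace G M \<and> skew_brace M G"

definition brace_star ::
  "('a, 'b) monoid_scheme \<Rightarrow> ('a, 'c) monoid_scheme \<Rightarrow> 'a \<Rightarrow> 'a \<Rightarrow> 'a" where
  "brace_star G M a b = inv\<^bsub>G\<^esub> a \<otimes>\<^bsub>G\<^esub> (a \<otimes>\<^bsub>M\<^esub> b) \<otimes>\<^bsub>G\<^esub> inv\<^bsub>G\<^esub> b"

definition brace_set_star ::
  "('a, 'b) monoid_scheme \<Rightarrow> ('a, 'c) monoid_scheme \<Rightarrow> 'a set \<Rightarrow> 'a set \<Rightarrow> 'a set" where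
  "brace_set_star G M X Y = generate G {brace_star G M x y | x y. x \<in> X \<and> y \<in> Y}"

(* Both series start at index 1; the value at index 0 is a dummy. *)
fun right_series ::
  "('a, 'b) monoid_scheme \<Rightarrow> ('a, 'c) monoid_scheme \<Rightarrow> nat \<Rightarrow> 'a set" where
  "right_series G M 0 = carrier G"
| "right_series G M (Suc 0) = carrier G"
| "right_series G M (Suc (Suc m)) =
    brace_set_star G M (right_series G M (Suc m)) (carrier G)"

fun left_series ::
  "('a, 'b) monoid_scheme \<Rightarrow> ('a, 'c) monoid_scheme \<Rightarrow> nat \<Rightarrow> 'a set" where
  "left_series G M 0 = carrier G"
| "left_series G M (Suc 0) = carrier G"
| "left_series G M (Suc (Suc m)) =
    brace_set_star G M (carrier G) (left_series G M (Suc m))"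

definition right_nilpotent ::
  "('a, 'b) monoid_scheme \<Rightarrow> ('a, 'c) monoid_scheme \<Rightarrow> bool" where
  "right_nilpotent G M \<longleftrightarrow> (\<exists>m\<ge>1. right_series G M m = {\<one>\<^bsub>G\<^esub>})"

definition left_nilpotent ::
  "('a, 'b) monoid_scheme \<Rightarrow> ('a, 'c) monoid_scheme \<Rightarrow> bool" where
  "left_nilpotent G M \<longleftrightarrow> (\<exists>m\<ge>1. left_series G M m = {\<one>\<^bsub>G\<^esub>})"

(* The two classes below are meaningful only for nilpotent skew braces. *)
definition right_nilpotency_class ::
  "('a, 'b) monoid_scheme \<Rightarrow> ('a, 'c) monoid_scheme \<Rightarrow> nat" where
  "right_nilpotency_class G M = (LEAST m. m \<ge> 1 \<and> right_series G M m = {\<one>\<^bsub>G\<^esub>}) - 1"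

definition left_nilpotency_class ::
  "('a, 'b) monoid_scheme \<Rightarrow> ('a, 'c) monoid_scheme \<Rightarrow> nat" where
  "left_nilpotency_class G M = (LEAST m. m \<ge> 1 \<and> left_series G M m = {\<one>\<^bsub>G\<^esub>}) - 1"

definition right_nilpotent_of_class ::
  "('a, 'b) monoid_scheme \<Rightarrow> ('a, 'c) monoid_scheme \<Rightarrow> nat \<Rightarrow> bool" where
  "right_nilpotent_of_class G M n \<longleftrightarrow> right_nilpotent G M \<and> right_nilpotency_class G M = n"

definition left_nilpotent_of_class ::
  "('a, 'b) monoid_scheme \<Rightarrow> ('a, 'c) monoid_scheme \<Rightarrow> nat \<Rightarrow> bool" where
  "left_nilpotent_of_class G M n \<longleftrightarrow> left_nilpotent G M \<and> left_nilpotency_class G M = n"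

end

theory Submission
  imports Defs
begin

text \<open>
  The two skew braces have literally the same left series and the same right series, term by
  term, although each term is generated by different elements under a different operation.

  Write \<open>A\<close> for the common carrier, \<open>\<cdot>\<close> for the operation of \<open>G\<close>, \<open>\<circ>\<close> for that of \<open>M\<close>, \<open>x'\<close> for the inverse of \<open>x\<close>
  in \<open>M\<close>, and \<open>\<lambda>\<^sub>a b = a\<^sup>-\<^sup>1 \<cdot> (a \<circ> b)\<close>. In a skew brace \<open>\<lambda>\<close> is an action of
  \<open>M\<close> by automorphisms of \<open>G\<close>, and \<open>a * b = \<lambda>\<^sub>a b \<cdot> b\<^sup>-\<^sup>1\<close>. Swapping the operations replaces
  \<open>\<lambda>\<^sub>a\<close> by its inverse (lemma \<open>lam_swap\<close>), so both braces have the same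
  \<open>\<lambda>\<close>-invariant subsets. Moreover a subgroup of \<open>G\<close> that is \<open>\<lambda>\<close>-invariant is also a subgroup
  of \<open>M\<close>, because \<open>a \<circ> b = a \<cdot> \<lambda>\<^sub>a b\<close>. Hence the operation used to generate a term of the series
  does not matter once the term is known to be \<open>\<lambda>\<close>-invariant.

  The generators are compared by lemma \<open>star_swap\<close>: the star \<open>c\<close> of \<open>x\<close> and \<open>b\<close> in the swapped
  brace equals \<open>(x' * b) \<cdot> (c * b)\<^sup>-\<^sup>1\<close>. If \<open>X\<close> contains \<open>x\<close>, \<open>x'\<close> and \<open>c\<close>, this lies in \<open>X * Y\<close>
  for every \<open>Y\<close> containing \<open>b\<close>. When \<open>X\<close> is an ideal, \<open>c\<close> does lie in \<open>X\<close>. So the set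
  product formed in the swapped brace is contained in \<open>X * Y\<close>. Bi-skewness enters here: the
  argument can be repeated with the operations exchanged, which gives equality
  (lemma \<open>set_star_swap_eq\<close>).

  It remains to carry the needed hypotheses along the series. For the left series \<open>X\<close> is the
  whole brace and only the \<open>\<lambda>\<close>-invariance of \<open>Y\<close> must be propagated. For the right series \<open>Y\<close> is
  the whole brace and \<open>X\<close> must remain an ideal. Normality of \<open>X * A\<close> in \<open>G\<close> is a direct
  computation, and the same computation in the swapped brace, applied to the same set, gives
  normality in \<open>M\<close>.
\<close>

section \<open>The lambda action\<close>

definition lam ::
  "('a, 'b) monoid_scheme \<Rightarrow> ('a, 'c) monoid_scheme \<Rightarrow> 'a \<Rightarrow> 'a \<Rightarrow> 'a" where
  "lam G M a b = inv\<^bsub>G\<^esub> a \<otimes>\<^bsub>G\<^esub> (a \<otimes>\<^bsub>M\<^esub> b)"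

definition lam_invariant ::
  "('a, 'b) monoid_scheme \<Rightarrow> ('a, 'c) monoid_scheme \<Rightarrow> 'a set \<Rightarrow> bool" where
  "lam_invariant G M Y \<longleftrightarrow>
     Y \<subseteq> carrier G \<and> (\<forall>a\<in>carrier G. \<forall>y\<in>Y. lam G M a y \<in> Y)"

text \<open>
  The usual notion of an ideal of a skew brace: what kernels of homomorphisms satisfy. Together the three
  conditions are preserved by swapping the operations of a bi-skew brace.
\<close>

definition brace_ideal ::
  "('a, 'b) monoid_scheme \<Rightarrow> ('a, 'c) monoid_scheme \<Rightarrow> 'a set \<Rightarrow> bool" where
  "brace_ideal G M X \<longleftrightarrow> X \<lhd> G \<and> X \<lhd> M \<and> lam_invariant G M X"

context skew_brace
begin

lemma mult_m_closed: "\<lbrakk>a \<in> carrier G; b \<in> carrier G\<rbrakk> \<Longrightarrow> a \<otimes>\<^bsub>M\<^esub> b \<in> carrier G"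
  using mult.m_closed carrier_eq by auto

lemma mult_inv_closed: "a \<in> carrier G \<Longrightarrow> inv\<^bsub>M\<^esub> a \<in> carrier G"
  using mult.inv_closed carrier_eq by auto

lemma mult_one_closed: "\<one>\<^bsub>M\<^esub> \<in> carrier G"
  using mult.one_closed carrier_eq by auto

lemma lam_closed: "\<lbrakk>a \<in> carrier G; b \<in> carrier G\<rbrakk> \<Longrightarrow> lam G M a b \<in> carrier G"
  by (simp add: lam_def mult_m_closed)

lemmas closed = mult_m_closed mult_inv_closed mult_one_closed lam_closed

lemma one_eq: "\<one>\<^bsub>M\<^esub> = \<one>\<^bsub>G\<^esub>"
proof -
  let ?e = "\<one>\<^bsub>M\<^esub>"
  have e: "?e \<in> carrier G" "\<And>x. x \<in> carrier G \<Longrightarrow> ?e \<otimes>\<^bsub>M\<^esub> x = x"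
    using closed mult.l_one carrier_eq by auto
  have "?e \<otimes>\<^bsub>M\<^esub> (\<one>\<^bsub>G\<^esub> \<otimes>\<^bsub>G\<^esub> \<one>\<^bsub>G\<^esub>) = \<one>\<^bsub>G\<^esub> \<otimes>\<^bsub>G\<^esub> inv\<^bsub>G\<^esub> ?e \<otimes>\<^bsub>G\<^esub> \<one>\<^bsub>G\<^esub>"
    using brace[of ?e "\<one>\<^bsub>G\<^esub>" "\<one>\<^bsub>G\<^esub>"] e by simp
  then have "inv\<^bsub>G\<^esub> ?e = \<one>\<^bsub>G\<^esub>" using e by simp
  then show ?thesis using e(1) by (metis add.inv_inv add.inv_one)
qed

lemma mult_eq_add_lam:
  "\<lbrakk>a \<in> carrier G; b \<in> carrier G\<rbrakk> \<Longrightarrow> a \<otimes>\<^bsub>M\<^esub> b = a \<otimes>\<^bsub>G\<^esub> lam G M a b"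
  by (simp add: lam_def closed add.m_assoc[symmetric])

text \<open>The brace law says exactly that each \<open>\<lambda>\<^sub>a\<close> respects the additive operation.\<close>

lemma lam_add:
  "\<lbrakk>a \<in> carrier G; b \<in> carrier G; c \<in> carrier G\<rbrakk>
   \<Longrightarrow> lam G M a (b \<otimes>\<^bsub>G\<^esub> c) = lam G M a b \<otimes>\<^bsub>G\<^esub> lam G M a c"
  by (simp add: lam_def brace closed add.m_assoc)

lemma lam_hom: "a \<in> carrier G \<Longrightarrow> group_hom G G (lam G M a)"
  by unfold_locales (auto simp: hom_def closed lam_add)

lemma lam_inv:
  "\<lbrakk>a \<in> carrier G; b \<in> carrier G\<rbrakk> \<Longrightarrow> lam G M a (inv\<^bsub>G\<^esub> b) = inv\<^bsub>G\<^esub> (lam G M a b)"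
  using group_hom.hom_inv[OF lam_hom] by blast

lemma lam_one: "b \<in> carrier G \<Longrightarrow> lam G M \<one>\<^bsub>M\<^esub> b = b"
  using mult.l_one carrier_eq by (simp add: lam_def one_eq[symmetric]) (simp add: one_eq)

text \<open>
  Compute \<open>a \<circ> b \<circ> c\<close> with both bracketings, rewriting \<open>\<circ>\<close> through \<open>\<cdot>\<close> and \<open>\<lambda>\<close>, and cancel
  \<open>a \<circ> b\<close> on the left.
\<close>

lemma lam_mult:
  assumes "a \<in> carrier G" "b \<in> carrier G" "c \<in> carrier G"
  shows "lam G M (a \<otimes>\<^bsub>M\<^esub> b) c = lam G M a (lam G M b c)"
proof -
  have "(a \<otimes>\<^bsub>M\<^esub> b) \<otimes>\<^bsub>G\<^esub> lam G M (a \<otimes>\<^bsub>M\<^esub> b) c = a \<otimes>\<^bsub>M\<^esub> (b \<otimes>\<^bsub>M\<^esub> c)"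
    using assms mult_eq_add_lam[of "a \<otimes>\<^bsub>M\<^esub> b" c] mult.m_assoc carrier_eq by (simp add: closed)
  also have "\<dots> = a \<otimes>\<^bsub>G\<^esub> lam G M a (b \<otimes>\<^bsub>G\<^esub> lam G M b c)"
    using assms by (simp add: mult_eq_add_lam closed)
  also have "\<dots> = (a \<otimes>\<^bsub>M\<^esub> b) \<otimes>\<^bsub>G\<^esub> lam G M a (lam G M b c)"
    using assms by (simp add: mult_eq_add_lam[of a b] lam_add closed add.m_assoc)
  finally show ?thesis using assms by (simp add: closed)
qed

lemma lam_lam_inv:
  "\<lbrakk>a \<in> carrier G; b \<in> carrier G\<rbrakk> \<Longrightarrow> lam G M a (lam G M (inv\<^bsub>M\<^esub> a) b) = b"
  using lam_mult[of a "inv\<^bsub>M\<^esub> a" b] lam_one mult.r_inv carrier_eq by (simp add: closed)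

lemma lam_inv_lam:
  "\<lbrakk>a \<in> carrier G; b \<in> carrier G\<rbrakk> \<Longrightarrow> lam G M (inv\<^bsub>M\<^esub> a) (lam G M a b) = b"
  using lam_mult[of "inv\<^bsub>M\<^esub> a" a b] lam_one mult.l_inv carrier_eq by (simp add: closed)

text \<open>
  Solve \<open>a \<cdot> b = a \<circ> u\<close> for \<open>u\<close>: since \<open>a \<circ> u = a \<cdot> \<lambda>\<^sub>a u\<close>, the solution is \<open>\<lambda>\<^sub>a\<^sup>-\<^sup>1 b\<close>. By
  definition it is also the value at \<open>b\<close> of the map \<open>\<lambda>\<^sub>a\<close> of the swapped pair.
\<close>

lemma lam_swap:
  assumes "a \<in> carrier G" "b \<in> carrier G"
  shows "lam M G a b = lam G M (inv\<^bsub>M\<^esub> a) b"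
proof -
  have "a \<otimes>\<^bsub>M\<^esub> lam G M (inv\<^bsub>M\<^esub> a) b = a \<otimes>\<^bsub>G\<^esub> b"
    using assms by (simp add: mult_eq_add_lam lam_lam_inv closed)
  then have "lam M G a b = inv\<^bsub>M\<^esub> a \<otimes>\<^bsub>M\<^esub> (a \<otimes>\<^bsub>M\<^esub> lam G M (inv\<^bsub>M\<^esub> a) b)"
    by (simp add: lam_def)
  also have "\<dots> = lam G M (inv\<^bsub>M\<^esub> a) b"
    using assms carrier_eq by (simp add: mult.m_assoc[symmetric] closed)
  finally show ?thesis .
qed

lemma lam_invariant_swap: "lam_invariant G M Y \<Longrightarrow> lam_invariant M G Y"
  unfolding lam_invariant_def using carrier_eq lam_swap closed by (auto simp: subset_iff)

lemma lam_invariant_carrier: "lam_invariant G M (carrier G)"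
  by (auto simp: lam_invariant_def closed)

text \<open>
  This makes it irrelevant whether a \<open>\<lambda>\<close>-invariant term of a series is generated inside \<open>G\<close> or
  inside \<open>M\<close>. Products and inverses in \<open>M\<close> are those of \<open>G\<close> twisted by \<open>\<lambda>\<close>: \<open>a \<circ> b = a \<cdot> \<lambda>\<^sub>a b\<close>,
  and the inverse of \<open>a\<close> in \<open>M\<close> is \<open>(\<lambda>\<^sub>u a)\<^sup>-\<^sup>1\<close>, where \<open>u\<close> is that inverse itself.
\<close>

lemma invariant_subgroup_mult:
  assumes "subgroup Y G" "lam_invariant G M Y"
  shows "subgroup Y M"
proof -
  have sub: "Y \<subseteq> carrier G" and inv: "\<And>a y. a \<in> carrier G \<Longrightarrow> y \<in> Y \<Longrightarrow> lam G M a y \<in> Y"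
    using assms(2) by (auto simp: lam_invariant_def)
  show ?thesis
  proof (rule mult.subgroupI)
    show "Y \<subseteq> carrier M" using sub carrier_eq by simp
    show "Y \<noteq> {}" using assms(1) subgroup.one_closed by blast
  next
    fix a b assume ab: "a \<in> Y" "b \<in> Y"
    then show "a \<otimes>\<^bsub>M\<^esub> b \<in> Y"
      using sub inv assms(1) by (auto simp: mult_eq_add_lam subset_iff subgroup.m_closed)
  next
    fix a assume a: "a \<in> Y"
    then have ac: "a \<in> carrier G" using sub by auto
    have "\<one>\<^bsub>G\<^esub> = inv\<^bsub>M\<^esub> a \<otimes>\<^bsub>G\<^esub> lam G M (inv\<^bsub>M\<^esub> a) a"
      using ac mult.l_inv carrier_eq
      by (simp add: mult_eq_add_lam[symmetric] closed one_eq[symmetric])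
    then have "inv\<^bsub>M\<^esub> a = inv\<^bsub>G\<^esub> (lam G M (inv\<^bsub>M\<^esub> a) a)"
      using ac by (metis add.inv_equality closed(2,4))
    then show "inv\<^bsub>M\<^esub> a \<in> Y"
      using ac a inv assms(1) by (metis mult_inv_closed subgroup.m_inv_closed)
  qed
qed

section \<open>The star operation\<close>

lemma star_eq_lam: "brace_star G M a b = lam G M a b \<otimes>\<^bsub>G\<^esub> inv\<^bsub>G\<^esub> b"
  by (simp add: brace_star_def lam_def)

lemma star_closed: "\<lbrakk>a \<in> carrier G; b \<in> carrier G\<rbrakk> \<Longrightarrow> brace_star G M a b \<in> carrier G"
  by (simp add: star_eq_lam closed)

text \<open>
  Because \<open>\<lambda>\<^sub>a \<lambda>\<^sub>x = \<lambda>\<^sub>z \<lambda>\<^sub>a\<close> with \<open>z\<close> the conjugate of \<open>x\<close> by \<open>a\<close> in \<open>M\<close>, a set product \<open>X * Y\<close>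
  inherits \<open>\<lambda>\<close>-invariance from \<open>Y\<close> as soon as \<open>X\<close> is normal in \<open>M\<close>.
\<close>

lemma lam_star:
  assumes "a \<in> carrier G" "x \<in> carrier G" "y \<in> carrier G"
  shows "lam G M a (brace_star G M x y)
       = brace_star G M (a \<otimes>\<^bsub>M\<^esub> x \<otimes>\<^bsub>M\<^esub> inv\<^bsub>M\<^esub> a) (lam G M a y)"
  using assms by (simp add: star_eq_lam lam_add lam_inv lam_mult lam_inv_lam closed)

text \<open>
  Expanding \<open>\<lambda>\<^sub>x (b \<cdot> c) = \<lambda>\<^sub>x b \<cdot> \<lambda>\<^sub>x c\<close> gives \<open>x * (b \<cdot> c) = (x * b) \<cdot> b \<cdot> (x * c) \<cdot> b\<^sup>-\<^sup>1\<close>.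
  Solved for the conjugate, this is the source of the normality of \<open>X * A\<close> in \<open>G\<close>.
\<close>

lemma conj_star:
  assumes "x \<in> carrier G" "b \<in> carrier G" "c \<in> carrier G"
  shows "b \<otimes>\<^bsub>G\<^esub> brace_star G M x c \<otimes>\<^bsub>G\<^esub> inv\<^bsub>G\<^esub> b
       = inv\<^bsub>G\<^esub> (brace_star G M x b) \<otimes>\<^bsub>G\<^esub> brace_star G M x (b \<otimes>\<^bsub>G\<^esub> c)"
proof -
  have "inv\<^bsub>G\<^esub> (lam G M x b) \<otimes>\<^bsub>G\<^esub> (lam G M x b \<otimes>\<^bsub>G\<^esub> z) = z" if "z \<in> carrier G" for z
    using assms that by (simp add: add.m_assoc[symmetric] closed)
  then show ?thesis
    using assms
    by (simp add: star_eq_lam lam_add add.inv_mult_group closed add.m_assoc)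
qed

text \<open>
  The comparison of the two star operations. Put \<open>y = \<lambda>\<^sub>x\<^sup>-\<^sup>1 b\<close> and let \<open>c = y \<circ> b'\<close> be the star of
  the swapped brace, where \<open>b'\<close> is the inverse of \<open>b\<close> in \<open>M\<close>. Since \<open>b' = \<lambda>\<^bsub>b'\<^esub> (b\<^sup>-\<^sup>1)\<close>, one gets
  \<open>c = y \<cdot> \<lambda>\<^sub>y (\<lambda>\<^bsub>b'\<^esub> (b\<^sup>-\<^sup>1)) = y \<cdot> \<lambda>\<^sub>c (b\<^sup>-\<^sup>1)\<close>, and inserting \<open>b\<^sup>-\<^sup>1 \<cdot> b\<close> splits this into two
  ordinary stars. That \<open>c\<close> occurs on both sides is harmless: the formula serves to place
  \<open>c\<close> in a set product whose left factor is already known to contain \<open>c\<close>.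
\<close>

lemma star_swap:
  assumes "x \<in> carrier G" "b \<in> carrier G"
  shows "brace_star M G x b = brace_star G M (inv\<^bsub>M\<^esub> x) b
       \<otimes>\<^bsub>G\<^esub> inv\<^bsub>G\<^esub> (brace_star G M (brace_star M G x b) b)"
proof -
  define y where "y = lam G M (inv\<^bsub>M\<^esub> x) b"
  define c where "c = y \<otimes>\<^bsub>M\<^esub> inv\<^bsub>M\<^esub> b"
  have cl: "y \<in> carrier G" "c \<in> carrier G" using assms by (simp_all add: y_def c_def closed)
  have c: "brace_star M G x b = c"
    using lam_swap[OF assms] by (simp add: brace_star_def lam_def y_def c_def)
  have "inv\<^bsub>M\<^esub> b \<otimes>\<^bsub>G\<^esub> lam G M (inv\<^bsub>M\<^esub> b) b = \<one>\<^bsub>G\<^esub>"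
    using assms mult.l_inv carrier_eq
    by (simp add: mult_eq_add_lam[symmetric] closed one_eq[symmetric])
  then have "inv\<^bsub>M\<^esub> b = lam G M (inv\<^bsub>M\<^esub> b) (inv\<^bsub>G\<^esub> b)"
    using assms by (metis add.inv_equality closed(2,4) lam_inv)
  then have "c = y \<otimes>\<^bsub>G\<^esub> lam G M c (inv\<^bsub>G\<^esub> b)"
    using assms cl mult_eq_add_lam[of y "inv\<^bsub>M\<^esub> b"] lam_mult[of y "inv\<^bsub>M\<^esub> b" "inv\<^bsub>G\<^esub> b"]
    by (simp add: c_def closed)
  \<comment> \<open>insert \<open>b\<^sup>-\<^sup>1 \<cdot> b\<close> between the two factors\<close>
  also have "\<dots> = (y \<otimes>\<^bsub>G\<^esub> inv\<^bsub>G\<^esub> b) \<otimes>\<^bsub>G\<^esub> inv\<^bsub>G\<^esub> (lam G M c b \<otimes>\<^bsub>G\<^esub> inv\<^bsub>G\<^esub> b)"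
  proof -
    have "inv\<^bsub>G\<^esub> b \<otimes>\<^bsub>G\<^esub> (b \<otimes>\<^bsub>G\<^esub> z) = z" if "z \<in> carrier G" for z
      using assms that by (simp add: add.m_assoc[symmetric])
    then show ?thesis
      using assms cl by (simp add: lam_inv add.inv_mult_group closed add.m_assoc)
  qed
  finally show ?thesis by (simp add: c) (simp add: star_eq_lam y_def)
qed

text \<open>
  Modulo an ideal, \<open>x \<circ> b\<close> and \<open>x \<cdot> b\<close> both reduce to \<open>b\<close>. Concretely, normality in \<open>M\<close> moves \<open>x\<close>
  to the right of \<open>b\<close>, \<open>\<lambda>\<close>-invariance turns that \<open>\<circ>\<close> into \<open>\<cdot>\<close>, and normality in \<open>G\<close> moves the
  resulting element back to the left.
\<close>

lemma ideal_star_mem: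
  assumes "brace_ideal G M X" "x \<in> X" "b \<in> carrier G"
  shows "brace_star G M x b \<in> X"
proof -
  define z where "z = inv\<^bsub>M\<^esub> b \<otimes>\<^bsub>M\<^esub> x \<otimes>\<^bsub>M\<^esub> b"
  have nG: "X \<lhd> G" and nM: "X \<lhd> M" and li: "lam_invariant G M X"
    using assms(1) by (auto simp: brace_ideal_def)
  have xc: "x \<in> carrier G" using li assms(2) by (auto simp: lam_invariant_def)
  have z: "z \<in> X" unfolding z_def
    using normal.inv_op_closed1[OF nM] assms carrier_eq by auto
  have zc: "z \<in> carrier G" using li z by (auto simp: lam_invariant_def)
  have "x \<otimes>\<^bsub>M\<^esub> b = b \<otimes>\<^bsub>M\<^esub> z"
    using xc assms(3) carrier_eq mult.m_assoc[symmetric] mult.r_inv mult.l_one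
    by (simp add: z_def closed)
  then have "brace_star G M x b
      = inv\<^bsub>G\<^esub> x \<otimes>\<^bsub>G\<^esub> (b \<otimes>\<^bsub>G\<^esub> lam G M b z \<otimes>\<^bsub>G\<^esub> inv\<^bsub>G\<^esub> b)"
    using xc zc assms(3) by (simp add: brace_star_def mult_eq_add_lam closed add.m_assoc)
  moreover have "b \<otimes>\<^bsub>G\<^esub> lam G M b z \<otimes>\<^bsub>G\<^esub> inv\<^bsub>G\<^esub> b \<in> X"
    using normal.inv_op_closed2[OF nG] li z assms(3) by (auto simp: lam_invariant_def)
  ultimately show ?thesis
    using normal_imp_subgroup[OF nG] assms(2)
    by (simp add: subgroup.m_closed subgroup.m_inv_closed)
qed

lemma star_set_subset:
  "\<lbrakk>X \<subseteq> carrier G; Y \<subseteq> carrier G\<rbrakk>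
   \<Longrightarrow> {brace_star G M x y | x y. x \<in> X \<and> y \<in> Y} \<subseteq> carrier G"
  by (auto simp: star_closed subset_iff)

lemma set_star_subgroup:
  "\<lbrakk>X \<subseteq> carrier G; Y \<subseteq> carrier G\<rbrakk> \<Longrightarrow> subgroup (brace_set_star G M X Y) G"
  unfolding brace_set_star_def by (rule add.generate_is_subgroup[OF star_set_subset])

lemma star_mem_set_star: "\<lbrakk>x \<in> X; y \<in> Y\<rbrakk> \<Longrightarrow> brace_star G M x y \<in> brace_set_star G M X Y"
  unfolding brace_set_star_def by (rule generate.incl) blast

text \<open>
  An endomorphism of \<open>G\<close> preserves \<open>X * Y\<close> once it maps the generators into it. It is applied to
  the maps \<open>\<lambda>\<^sub>a\<close> and to inner automorphisms; by lemma \<open>conj_star\<close>, an inner automorphism sends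
  a generator to a product of generators and inverses, in general not to a generator.
\<close>

lemma set_star_hom_closed:
  assumes "X \<subseteq> carrier G" "Y \<subseteq> carrier G" "group_hom G G f"
    and f: "\<And>x y. x \<in> X \<Longrightarrow> y \<in> Y \<Longrightarrow> f (brace_star G M x y) \<in> brace_set_star G M X Y"
    and "z \<in> brace_set_star G M X Y"
  shows "f z \<in> brace_set_star G M X Y"
proof -
  let ?S = "{brace_star G M x y | x y. x \<in> X \<and> y \<in> Y}"
  have "f ` brace_set_star G M X Y = generate G (f ` ?S)"
    unfolding brace_set_star_def
    using group_hom.generate_img[OF assms(3) star_set_subset] assms(1,2) by blast
  also have "\<dots> \<subseteq> brace_set_star G M X Y"
    by (rule add.generate_subgroup_incl) (use f set_star_subgroup assms(1,2) in auto)
  finally show ?thesis using assms(5) by blast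
qed

lemma set_star_lam_invariant:
  assumes X: "X \<lhd> M" and Y: "lam_invariant G M Y"
  shows "lam_invariant G M (brace_set_star G M X Y)"
proof -
  have sub: "X \<subseteq> carrier G" "Y \<subseteq> carrier G"
    using normal_imp_subgroup[OF X] subgroup.subset carrier_eq Y by (auto simp: lam_invariant_def)
  have "lam G M a z \<in> brace_set_star G M X Y"
    if a: "a \<in> carrier G" and z: "z \<in> brace_set_star G M X Y" for a z
  proof (rule set_star_hom_closed[OF sub lam_hom[OF a] _ z])
    fix x y assume xy: "x \<in> X" "y \<in> Y"
    have "a \<otimes>\<^bsub>M\<^esub> x \<otimes>\<^bsub>M\<^esub> inv\<^bsub>M\<^esub> a \<in> X"
      using normal.inv_op_closed2[OF X] a xy carrier_eq by auto
    moreover have "lam G M a y \<in> Y" using Y a xy by (auto simp: lam_invariant_def)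
    ultimately show "lam G M a (brace_star G M x y) \<in> brace_set_star G M X Y"
      using lam_star[of a x y] a xy sub star_mem_set_star by (metis subsetD)
  qed
  then show ?thesis
    using subgroup.subset[OF set_star_subgroup[OF sub]] by (auto simp: lam_invariant_def)
qed

lemma set_star_carrier_normal:
  assumes X: "X \<subseteq> carrier G"
  shows "brace_set_star G M X (carrier G) \<lhd> G"
proof -
  let ?Y = "brace_set_star G M X (carrier G)"
  have sg: "subgroup ?Y G" by (rule set_star_subgroup[OF X subset_refl])
  have "b \<otimes>\<^bsub>G\<^esub> z \<otimes>\<^bsub>G\<^esub> inv\<^bsub>G\<^esub> b \<in> ?Y" if b: "b \<in> carrier G" and z: "z \<in> ?Y" for b z
  proof (rule set_star_hom_closed[OF X subset_refl _ _ z])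
    have "inv\<^bsub>G\<^esub> b \<otimes>\<^bsub>G\<^esub> (b \<otimes>\<^bsub>G\<^esub> u) = u" if "u \<in> carrier G" for u
      using b that by (simp add: add.m_assoc[symmetric])
    then show "group_hom G G (\<lambda>u. b \<otimes>\<^bsub>G\<^esub> u \<otimes>\<^bsub>G\<^esub> inv\<^bsub>G\<^esub> b)"
      using b by unfold_locales (auto simp: hom_def add.m_assoc)
  next
    fix x c assume "x \<in> X" "c \<in> carrier G"
    then show "b \<otimes>\<^bsub>G\<^esub> brace_star G M x c \<otimes>\<^bsub>G\<^esub> inv\<^bsub>G\<^esub> b \<in> ?Y"
      using conj_star[of x b c] b X sg
      by (auto simp: subset_iff star_mem_set_star subgroup.m_closed subgroup.m_inv_closed)
  qed
  then show ?thesis using sg add.normal_inv_iff by blast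
qed

text \<open>
  The last assumption places the element \<open>c\<close> of lemma \<open>star_swap\<close> in \<open>X\<close>, so that the
  generators of the swapped product lie in \<open>X * Y\<close>, which is a subgroup of \<open>M\<close> as well.
\<close>

lemma set_star_swap_subset:
  assumes X: "X \<lhd> M" and Y: "lam_invariant G M Y"
    and XY: "\<And>x y. x \<in> X \<Longrightarrow> y \<in> Y \<Longrightarrow> brace_star M G x y \<in> X"
  shows "brace_set_star M G X Y \<subseteq> brace_set_star G M X Y"
proof -
  let ?S = "brace_set_star G M X Y"
  have sub: "X \<subseteq> carrier G" "Y \<subseteq> carrier G"
    using normal_imp_subgroup[OF X] subgroup.subset carrier_eq Y by (auto simp: lam_invariant_def)
  have sg: "subgroup ?S G" by (rule set_star_subgroup[OF sub])
  have "brace_star M G x y \<in> ?S" if xy: "x \<in> X" "y \<in> Y" for x y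
  proof -
    have "inv\<^bsub>M\<^esub> x \<in> X"
      using normal_imp_subgroup[OF X] xy by (simp add: subgroup.m_inv_closed)
    then have "brace_star G M (inv\<^bsub>M\<^esub> x) y \<in> ?S"
      and "brace_star G M (brace_star M G x y) y \<in> ?S"
      using XY xy star_mem_set_star by auto
    then have "brace_star G M (inv\<^bsub>M\<^esub> x) y
        \<otimes>\<^bsub>G\<^esub> inv\<^bsub>G\<^esub> (brace_star G M (brace_star M G x y) y) \<in> ?S"
      using sg by (simp add: subgroup.m_closed subgroup.m_inv_closed)
    then show ?thesis
      by (subst star_swap) (use xy sub in auto)
  qed
  then show ?thesis
    unfolding brace_set_star_def[of M]
    by (intro mult.generate_subgroup_incl
          invariant_subgroup_mult[OF sg set_star_lam_invariant[OF X Y]]) auto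
qed

lemma carrier_ideal: "brace_ideal G M (carrier G)"
  using add.normal_self mult.normal_self carrier_eq lam_invariant_carrier
  by (simp add: brace_ideal_def)

end

section \<open>The series of a bi-skew brace and of its swap\<close>

text \<open>
  With both \<open>(G, M)\<close> and \<open>(M, G)\<close> skew braces, the preceding inclusion applies in both directions,
  and lemma \<open>ideal_star_mem\<close> for either brace supplies its last hypothesis.
\<close>

lemma set_star_swap_eq:
  assumes "skew_brace G M" "skew_brace M G" "brace_ideal G M X" "lam_invariant G M Y"
  shows "brace_set_star M G X Y = brace_set_star G M X Y"
proof
  have X: "X \<lhd> G" "X \<lhd> M" "brace_ideal M G X"
    using assms(3) skew_brace.lam_invariant_swap[OF assms(1)] by (auto simp: brace_ideal_def)
  have Y: "Y \<subseteq> carrier G" "Y \<subseteq> carrier M" "lam_invariant M G Y"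
    using assms(4) skew_brace.lam_invariant_swap[OF assms(1)] by (auto simp: lam_invariant_def)
  show "brace_set_star M G X Y \<subseteq> brace_set_star G M X Y"
    by (rule skew_brace.set_star_swap_subset[OF assms(1) X(2) assms(4)])
      (use skew_brace.ideal_star_mem[OF assms(2) X(3)] Y in auto)
  show "brace_set_star G M X Y \<subseteq> brace_set_star M G X Y"
    by (rule skew_brace.set_star_swap_subset[OF assms(2) X(1) Y(3)])
      (use skew_brace.ideal_star_mem[OF assms(1,3)] Y in auto)
qed

text \<open>
  Normality in \<open>M\<close> is obtained by viewing the set as a product formed in the swapped brace, whose
  additive group is \<open>M\<close>.
\<close>

lemma set_star_ideal:
  assumes "skew_brace G M" "skew_brace M G" "brace_ideal G M X"
  shows "brace_ideal G M (brace_set_star G M X (carrier G))"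
proof -
  note c = skew_brace.carrier_eq[OF assms(1)]
  have X: "X \<lhd> M" "X \<subseteq> carrier G" 
    using assms(3) by (auto simp: brace_ideal_def lam_invariant_def)
  note inv = skew_brace.lam_invariant_carrier[OF assms(1)]
  have "brace_set_star M G X (carrier M) \<lhd> M"
    using skew_brace.set_star_carrier_normal[OF assms(2)] X c by simp
  then have "brace_set_star G M X (carrier G) \<lhd> M"
    using set_star_swap_eq[OF assms inv] c by simp
  then show ?thesis
    using skew_brace.set_star_carrier_normal[OF assms(1) X(2)]
      skew_brace.set_star_lam_invariant[OF assms(1) X(1) inv]
    by (simp add: brace_ideal_def)
qed

lemma left_series_swap:
  assumes "skew_brace G M" "skew_brace M G"
  shows "left_series M G m = left_series G M m \<and> lam_invariant G M (left_series G M m)"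
proof (cases m)
  \<comment> \<open>indices \<open>0\<close> and \<open>1\<close> both give the carrier; the recursion, hence the induction, starts at \<open>1\<close>\<close>
  case 0
  then show ?thesis
    using skew_brace.carrier_eq[OF assms(1)] skew_brace.lam_invariant_carrier[OF assms(1)] by simp
next
  case (Suc k)
  note c = skew_brace.carrier_eq[OF assms(1)]
  note ideal = skew_brace.carrier_ideal[OF assms(1)]
  have "left_series M G (Suc k) = left_series G M (Suc k) \<and>
      lam_invariant G M (left_series G M (Suc k))"
  proof (induction k)
    case 0
    show ?case using c skew_brace.lam_invariant_carrier[OF assms(1)] by simp
  next
    case (Suc k)
    have "carrier G \<lhd> M" using ideal by (simp add: brace_ideal_def)
    then show ?case
      using Suc.IH set_star_swap_eq[OF assms ideal] c
        skew_brace.set_star_lam_invariant[OF assms(1)] by simp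
  qed
  then show ?thesis by (simp only: Suc)
qed

lemma right_series_swap:
  assumes "skew_brace G M" "skew_brace M G"
  shows "right_series M G m = right_series G M m \<and> brace_ideal G M (right_series G M m)"
proof (cases m)
  \<comment> \<open>indices \<open>0\<close> and \<open>1\<close> both give the carrier; the recursion, hence the induction, starts at \<open>1\<close>\<close>
  case 0
  then show ?thesis
    using skew_brace.carrier_eq[OF assms(1)] skew_brace.carrier_ideal[OF assms(1)] by simp
next
  case (Suc k)
  note c = skew_brace.carrier_eq[OF assms(1)]
  have "right_series M G (Suc k) = right_series G M (Suc k) \<and>
      brace_ideal G M (right_series G M (Suc k))"
  proof (induction k)
    case 0
    show ?case using c skew_brace.carrier_ideal[OF assms(1)] by simp
  next
    case (Suc k)
    then show ?case
      using set_star_ideal[OF assms] c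
        set_star_swap_eq[OF assms _ skew_brace.lam_invariant_carrier[OF assms(1)]] by simp
  qed
  then show ?thesis by (simp only: Suc)
qed

theorem proposition3p4:
  fixes G :: "('a, 'b) monoid_scheme" and M :: "('a, 'c) monoid_scheme" and n :: nat
  assumes "bi_skew_brace G M"
  shows "(left_nilpotent_of_class G M n \<longleftrightarrow> left_nilpotent_of_class M G n) \<and>
         (right_nilpotent_of_class G M n \<longleftrightarrow> right_nilpotent_of_class M G n)"
proof -
  have sb: "skew_brace G M" "skew_brace M G" using assms by (simp_all add: bi_skew_brace_def)
  have "left_series M G = left_series G M" "right_series M G = right_series G M"
    using left_series_swap[OF sb] right_series_swap[OF sb] by auto
  then show ?thesis
    by (simp add: skew_brace.one_eq[OF sb(1)]
        left_nilpotent_of_class_def left_nilpotent_def left_nilpotency_class_def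
        right_nilpotent_of_class_def right_nilpotent_def right_nilpotency_class_def)
qed

end
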